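(* Let $\mathbf{S}$ be a proper scoring rule on a convex set $D$ of allowed distributions over a finite outcome space, such that each component of $\mathbf{S}$ is concave on $D$ and $\mathrm{nb}(\overline{\mathbf{q}},\mathbf{q})\le B$ for all $\overline{\mathbf{q}},\mathbf{q}\in D$, where $B>0$. The Scaled Scoring Mechanism (SSM) based on $\mathbf{S}$ and $B$ satisfies the following properties. 1. Myopic strategyproofness: assuming that each agent $i$ cannot report $b'_i$ higher than her true budget $b_i$, and that each trader trades just once, it is optimal (maximizes expected net payoff under her belief $\mathbf{p}_i\in D$) for each trader $i$ to report her true belief $\mathbf{q}_i=\mathbf{p}_i$ and her true budget $b'_i=b_i$. 2. No default: under any outcome, each agent $i$'s net payoff is at least $-b'_i$. 3. Budget-constrained truthful: after $i$ selects her optimal report, the forecast distribution $\overline{\mathbf{q}}_i$ is a mixture (convex combination) of the earlier forecast distribution $\overline{\mathbf{q}}_{i-1}$ and $i$'s true belief $\mathbf{p}_i$, for any budget $b_i$. 4. Limited loss: the worst-case loss of the market maker (the supremum, over all sequences of reports and budgets and all outcomes, of the sum of net payoffs paid to the agents) is no greater than the worst-case loss (the supremum over all report sequences and outcomes of the sum of net payoffs) of a market scoring rule market based on $\mathbf{S}$ for the same outcome space, with the same initial distribution $\overline{\mathbf{q}}_0$. 5. Myopic sybilproofness: it is never profitable for an agent to divide her budget among multiple identities who make consecutive reports. That is, for any belief $\mathbf{p}\in D$, any current forecast $\overline{\mathbf{q}}_{i-1}\in D$, and any $j$ consecutive reports $\mathbf{q}_{i1},\dots,\mathbf{q}_{ij}\in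 D$ with reported budgets $b_{i1},\dots,b_{ij}\ge 0$, there is a single report in $D$, made from $\overline{\mathbf{q}}_{i-1}$ with reported budget $b_{i1}+\dots+b_{ij}$, whose expected net payoff under $\mathbf{p}$ is at least the total expected net payoff under $\mathbf{p}$ of the $j$ consecutive reports.
   Context: Let $\Omega$ be a finite outcome space and $D$ the (convex) set of allowed probability distributions over $\Omega$. A scoring rule is a map $\mathbf{S}=(S_\omega)_{\omega\in\Omega}:D\to\mathbb{R}^{\Omega}$; it is proper if for each belief $\mathbf{p}\in D$ the honest report $\mathbf{q}=\mathbf{p}$ is the unique maximizer over $\mathbf{q}\in D$ of the expected score $\mathbf{p}\cdot\mathbf{S}(\mathbf{q})$. The natural budget is $\mathrm{nb}(\overline{\mathbf{q}},\mathbf{q})=\max_{\omega\in\Omega}[S_\omega(\overline{\mathbf{q}})-S_\omega(\mathbf{q})]$. Market scoring rule (MSR) based on $\mathbf{S}$: with initial distribution $\mathbf{q}_0$ and sequential reports $\mathbf{q}_1,\dots,\mathbf{q}_m$, agent $i$ receives net payoff $S_\omega(\mathbf{q}_i)-S_\omega(\mathbf{q}_{i-1})$ when outcome $\omega$ occurs. Scaled Scoring Mechanism: start from an arbitrary initial forecast $\overline{\mathbf{q}}_0\in D$. For $i=1,\dots,m$: agent $i$ reports a budget $b'_i\ge 0$ and a forecast $\mathbf{q}_i\in D$, and the market forecast is updated to $$\overline{\mathbf{q}}_i=\overline{\mathbf{q}}_{i-1}+\min\{1,b'_i/B\}\,(\mathbf{q}_i-\overline{\mathbf{q}}_{i-1}).$$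 When the outcome $\omega$ is revealed, each agent $i$ gets net payoff $$\min\{1,b'_i/B\}\,[S_\omega(\mathbf{q}_i)-S_\omega(\overline{\mathbf{q}}_{i-1})].$$ Agent $i$ has true belief $\mathbf{p}_i\in D$ and true budget $b_i\ge 0$, is risk neutral (maximizes expected net payoff), and may report any $b'_i\le b_i$ (she may under-report but not exaggerate her budget). *)

theory Defs
  imports "HOL-Analysis.Analysis"
begin

text \<open>
  Outcomes are the elements of a finite type. Distributions, score vectors and net payoff vectors
  are all vectors indexed by outcomes, so the expectation of \<open>x\<close> under belief \<open>p\<close> is \<open>p \<bullet> x\<close>.
\<close>

definition distributions :: "(real ^ 'w::finite) set" where
  "distributions = {p. (\<forall>\<omega>. 0 \<le> p $ \<omega>) \<and> (\<Sum>\<omega>\<in>UNIV. p $ \<omega>) = 1}"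

definition proper :: "(real ^ 'w::finite) set \<Rightarrow> (real ^ 'w \<Rightarrow> real ^ 'w) \<Rightarrow> bool" where
  "proper D S \<longleftrightarrow> (\<forall>p\<in>D. \<forall>q\<in>D. q \<noteq> p \<longrightarrow> p \<bullet> S q < p \<bullet> S p)"

definition natural_budget ::
    "(real ^ 'w::finite \<Rightarrow> real ^ 'w) \<Rightarrow> real ^ 'w \<Rightarrow> real ^ 'w \<Rightarrow> real" where
  "natural_budget S q' q = (MAX \<omega>\<in>UNIV. S q' $ \<omega> - S q $ \<omega>)"


definition msr_payoff ::
    "(real ^ 'w::finite \<Rightarrow> real ^ 'w) \<Rightarrow> real ^ 'w \<Rightarrow> (real ^ 'w) list \<Rightarrow> nat \<Rightarrow> real ^ 'w" where
  "msr_payoff S q0 qs i = S (qs ! i) - S ((q0 # qs) ! i)"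

text \<open>
  The suprema below are taken in the extended reals (unbounded loss is \<open>\<infinity>\<close>) and
  range over report sequences of every finite length.
\<close>

definition msr_worst_loss ::
    "(real ^ 'w::finite) set \<Rightarrow> (real ^ 'w \<Rightarrow> real ^ 'w) \<Rightarrow> real ^ 'w \<Rightarrow> ereal" where
  "msr_worst_loss D S q0 =
     (SUP (qs, \<omega>) \<in> lists D \<times> UNIV. ereal (\<Sum>i<length qs. msr_payoff S q0 qs i $ \<omega>))"


text \<open>
  A report is a pair of a budget and a forecast. Lists of reports are indexed from 0, so the
  report \<open>rs ! i\<close> is made when the market forecast is \<open>ssm_forecast B q0 (take i rs)\<close>.
\<close>

type_synonym 'w report = "real \<times> (real ^ 'w)"

definition reports :: "(real ^ 'w::finite) set \<Rightarrow> 'w report set" where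
  "reports D = {0..} \<times> D"

fun ssm_update :: "real \<Rightarrow> real ^ 'w::finite \<Rightarrow> 'w report \<Rightarrow> real ^ 'w" where
  "ssm_update B q' (b, q) = q' + min 1 (b / B) *\<^sub>R (q - q')"

definition ssm_forecast :: "real \<Rightarrow> real ^ 'w::finite \<Rightarrow> 'w report list \<Rightarrow> real ^ 'w" where
  "ssm_forecast B q0 rs = foldl (ssm_update B) q0 rs"

definition ssm_payoff ::
    "(real ^ 'w::finite \<Rightarrow> real ^ 'w) \<Rightarrow> real \<Rightarrow> real ^ 'w \<Rightarrow> 'w report list \<Rightarrow> nat \<Rightarrow> real ^ 'w" where
  "ssm_payoff S B q0 rs i =
     min 1 (fst (rs ! i) / B) *\<^sub>R (S (snd (rs ! i)) - S (ssm_forecast B q0 (take i rs)))"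

definition ssm_worst_loss ::
    "(real ^ 'w::finite) set \<Rightarrow> (real ^ 'w \<Rightarrow> real ^ 'w) \<Rightarrow> real \<Rightarrow> real ^ 'w \<Rightarrow> ereal" where
  "ssm_worst_loss D S B q0 =
     (SUP (rs, \<omega>) \<in> lists (reports D) \<times> UNIV.
        ereal (\<Sum>i<length rs. ssm_payoff S B q0 rs i $ \<omega>))"

text \<open>
  \<open>r\<close> is an optimal report for the \<open>i\<close>-th agent, with belief \<open>p\<close> and true budget \<open>b\<close>, when
  everybody else reports as in \<open>rs\<close>. The entry \<open>rs ! i\<close> itself is overwritten and irrelevant.
\<close>

definition optimal_report ::
    "(real ^ 'w::finite) set \<Rightarrow> (real ^ 'w \<Rightarrow> real ^ 'w) \<Rightarrow> real \<Rightarrow> real ^ 'w \<Rightarrow> 'w report list \<Rightarrow>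
       nat \<Rightarrow> real ^ 'w \<Rightarrow> real \<Rightarrow> 'w report \<Rightarrow> bool" where
  "optimal_report D S B q0 rs i p b r \<longleftrightarrow>
     r \<in> {0..b} \<times> D \<and>
     (\<forall>r'\<in>{0..b} \<times> D.
        p \<bullet> ssm_payoff S B q0 (rs[i := r']) i \<le> p \<bullet> ssm_payoff S B q0 (rs[i := r]) i)"

end

theory Submission
  imports Defs
begin

text \<open>
  Write \<open>\<lambda> = min 1 (b / B)\<close> for the weight of a report \<open>(b, q)\<close> made at the market forecast \<open>q'\<close>.
  By concavity, the payoff \<open>\<lambda> (S q - S q')\<close> is bounded in every component by \<open>S q'' - S q'\<close>, where
  \<open>q'' = q' + \<lambda> (q - q')\<close> is the updated forecast. The right-hand side is the payoff in the
  market scoring rule for moving the forecast from \<open>q'\<close> to \<open>q''\<close>, so the loss of the scaled mechanism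
  is dominated by that of the market scoring rule on the sequence of market forecasts.

  For sybils, let \<open>g\<close> be the gap \<open>p \<bullet> S p - p \<bullet> S q'\<close> at the current forecast, \<open>g\<^sub>0\<close> its initial
  value, and \<open>T\<close> the expected payoff collected so far. The same inequality gives \<open>T + g \<le> g\<^sub>0\<close>, and the next
  report collects at most \<open>\<lambda> g \<le> \<lambda> (g\<^sub>0 - T)\<close>; inductively \<open>T \<le> \<Lambda> g\<^sub>0\<close>, where \<open>\<Lambda>\<close> is the weight
  of the combined budget. Reporting \<open>p\<close> with the combined budget earns exactly \<open>\<Lambda> g\<^sub>0\<close>.
\<close>

lemma distributions_inner_mono:
  assumes "p \<in> distributions" "\<And>\<omega>. x $ \<omega> \<le> y $ \<omega>"
  shows "p \<bullet> x \<le> p \<bullet> y"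
  using assms by (auto simp: inner_vec_def distributions_def intro!: sum_mono mult_left_mono)

lemma ssm_forecast_Nil [simp]: "ssm_forecast B q0 [] = q0"
  by (simp add: ssm_forecast_def)

lemma ssm_forecast_snoc [simp]:
  "ssm_forecast B q0 (rs @ [r]) = ssm_update B (ssm_forecast B q0 rs) r"
  by (simp add: ssm_forecast_def)

lemma ssm_forecast_take_Suc:
  "i < length rs \<Longrightarrow>
    ssm_forecast B q0 (take (Suc i) rs) = ssm_update B (ssm_forecast B q0 (take i rs)) (rs ! i)"
  by (simp add: take_Suc_conv_app_nth)

lemma ssm_payoff_append:
  "i < length rs \<Longrightarrow> ssm_payoff S B q0 (rs @ rs') i = ssm_payoff S B q0 rs i"
  by (simp add: ssm_payoff_def nth_append)

lemma ssm_payoff_list_update: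
  "i < length rs \<Longrightarrow> ssm_payoff S B q0 (rs[i := r]) i =
    min 1 (fst r / B) *\<^sub>R (S (snd r) - S (ssm_forecast B q0 (take i rs)))"
  by (simp add: ssm_payoff_def)

lemma proper_le: "proper D S \<Longrightarrow> p \<in> D \<Longrightarrow> q \<in> D \<Longrightarrow> p \<bullet> S q \<le> p \<bullet> S p"
  unfolding proper_def by (cases "q = p") (auto intro: less_imp_le)

lemma report_nthE:
  assumes "rs \<in> lists (reports D)" "i < length rs"
  obtains b q where "rs ! i = (b, q)" "0 \<le> b" "q \<in> D"
proof -
  have "rs ! i \<in> reports D"
    using assms nth_mem by blast
  then show ?thesis
    by (auto simp: reports_def intro: that)
qed

text \<open>The initial forecast is not fixed here, since the sybil bound starts from an arbitrary
  current forecast.\<close>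

locale scaled_scoring =
  fixes D :: "(real ^ 'w::finite) set"
    and S :: "real ^ 'w \<Rightarrow> real ^ 'w"
    and B :: real
  assumes dist: "D \<subseteq> distributions"
    and conv: "convex D"
    and proper_S: "proper D S"
    and conc: "\<And>\<omega>. concave_on D (\<lambda>q. S q $ \<omega>)"
    and B_pos: "B > 0"
    and budget: "\<And>q' q. q' \<in> D \<Longrightarrow> q \<in> D \<Longrightarrow> natural_budget S q' q \<le> B"
begin

lemma weight_nonneg: "0 \<le> b \<Longrightarrow> 0 \<le> min 1 (b / B)"
  using B_pos by simp

lemma ssm_update_in:
  assumes "q' \<in> D" "r \<in> reports D"
  shows "ssm_update B q' r \<in> D"
proof -
  obtain b q where r: "r = (b, q)" "0 \<le> b" "q \<in> D"
    using assms(2) by (auto simp: reports_def)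
  let ?l = "min 1 (b / B)"
  have "(1 - ?l) *\<^sub>R q' + ?l *\<^sub>R q \<in> D"
    using conv assms(1) r weight_nonneg[of b] by (intro convexD) auto
  then show ?thesis
    by (simp add: r algebra_simps)
qed

lemma ssm_forecast_in:
  "q0 \<in> D \<Longrightarrow> rs \<in> lists (reports D) \<Longrightarrow> ssm_forecast B q0 rs \<in> D"
  by (induction rs rule: rev_induct) (auto intro: ssm_update_in)

lemma ssm_forecast_take_in:
  "q0 \<in> D \<Longrightarrow> rs \<in> lists (reports D) \<Longrightarrow> ssm_forecast B q0 (take i rs) \<in> D"
  by (rule ssm_forecast_in) (auto dest: in_set_takeD)

lemma scaled_gain_le:
  assumes "q' \<in> D" "q \<in> D" "0 \<le> b"
  shows "min 1 (b / B) * (S q $ \<omega> - S q' $ \<omega>) \<le> S (ssm_update B q' (b, q)) $ \<omega> - S q' $ \<omega>"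
proof -
  let ?l = "min 1 (b / B)"
  have "(1 - ?l) * S q' $ \<omega> + ?l * S q $ \<omega> \<le> S ((1 - ?l) *\<^sub>R q' + ?l *\<^sub>R q) $ \<omega>"
    using conc[of \<omega>] assms weight_nonneg[of b] unfolding concave_on_iff by simp
  moreover have "(1 - ?l) *\<^sub>R q' + ?l *\<^sub>R q = ssm_update B q' (b, q)"
    by (simp add: algebra_simps)
  ultimately show ?thesis
    by (simp add: algebra_simps)
qed

lemma expected_scaled_gain_le:
  assumes "p \<in> D" "q' \<in> D" "q \<in> D" "0 \<le> b"
  shows "min 1 (b / B) * (p \<bullet> S q - p \<bullet> S q') \<le> p \<bullet> S (ssm_update B q' (b, q)) - p \<bullet> S q'"
proof -
  have "p \<bullet> (min 1 (b / B) *\<^sub>R (S q - S q')) \<le> p \<bullet> (S (ssm_update B q' (b, q)) - S q')"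
    using assms dist scaled_gain_le[OF assms(2-4)] by (intro distributions_inner_mono) auto
  then show ?thesis
    by (simp add: inner_diff_right)
qed

text \<open>At a fixed weight, properness makes \<open>p\<close> the best forecast. Reporting
  \<open>p\<close> has nonnegative expected gain, so a larger weight, hence the full budget, can
  only help.\<close>

lemma truthful_optimal:
  assumes "q0 \<in> D" "rs \<in> lists (reports D)" "i < length rs" "p \<in> D" "0 \<le> b"
  shows "optimal_report D S B q0 rs i p b (b, p)"
  unfolding optimal_report_def
proof (intro conjI ballI)
  show "(b, p) \<in> {0..b} \<times> D"
    using assms by simp
next
  fix r assume "r \<in> {0..b} \<times> D"
  then obtain c q where r: "r = (c, q)" "0 \<le> c" "c \<le> b" "q \<in> D"
    by auto
  let ?q' = "ssm_forecast B q0 (take i rs)"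
  have "?q' \<in> D"
    using assms by (simp add: ssm_forecast_take_in)
  then have gap: "0 \<le> p \<bullet> S p - p \<bullet> S ?q'"
    using proper_le[OF proper_S assms(4)] by simp
  have "min 1 (c / B) * (p \<bullet> S q - p \<bullet> S ?q') \<le> min 1 (c / B) * (p \<bullet> S p - p \<bullet> S ?q')"
    using proper_le[OF proper_S assms(4) r(4)] r(2) weight_nonneg by (intro mult_left_mono) auto
  also have "\<dots> \<le> min 1 (b / B) * (p \<bullet> S p - p \<bullet> S ?q')"
    using gap r(3) B_pos by (intro mult_right_mono min.mono divide_right_mono) auto
  finally show "p \<bullet> ssm_payoff S B q0 (rs[i := r]) i \<le> p \<bullet> ssm_payoff S B q0 (rs[i := (b, p)]) i"
    using assms(3) by (simp add: ssm_payoff_list_update r inner_diff_right)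
qed

text \<open>The unscaled loss is at most \<open>B\<close> by the natural budget bound, and the
  weight is at most \<open>b / B\<close>, so the scaled loss is at most \<open>b\<close>.\<close>

lemma no_default:
  assumes "q0 \<in> D" "rs \<in> lists (reports D)" "i < length rs"
  shows "- fst (rs ! i) \<le> ssm_payoff S B q0 rs i $ \<omega>"
proof -
  obtain b q where r: "rs ! i = (b, q)" "0 \<le> b" "q \<in> D"
    using assms(2,3) by (rule report_nthE)
  let ?q' = "ssm_forecast B q0 (take i rs)"
  have "S ?q' $ \<omega> - S q $ \<omega> \<le> natural_budget S ?q' q"
    unfolding natural_budget_def by (intro Max_ge) auto
  also have "\<dots> \<le> B"
    using assms r by (intro budget ssm_forecast_take_in)
  finally have "min 1 (b / B) * (S ?q' $ \<omega> - S q $ \<omega>) \<le> min 1 (b / B) * B"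
    using weight_nonneg[OF r(2)] by (rule mult_left_mono)
  also have "\<dots> \<le> b / B * B"
    using B_pos by (intro mult_right_mono) auto
  finally show ?thesis
    using B_pos by (simp add: ssm_payoff_def r algebra_simps)
qed

lemma optimal_report_update:
  assumes "q0 \<in> D" "rs \<in> lists (reports D)" "i < length rs" "p \<in> D"
    and opt: "optimal_report D S B q0 rs i p b r"
  shows "ssm_forecast B q0 (take (Suc i) (rs[i := r]))
    \<in> closed_segment (ssm_forecast B q0 (take i rs)) p"
proof -
  let ?q' = "ssm_forecast B q0 (take i rs)"
  obtain c q where r: "r = (c, q)" "0 \<le> c" "c \<le> b" "q \<in> D"
    using opt by (auto simp: optimal_report_def)
  let ?l = "min 1 (c / B)"
  \<comment> \<open>The competitor \<open>(c, p)\<close> keeps the budget of the optimal report, so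
    both payoffs carry the same weight and the terms in \<open>?q'\<close> cancel.\<close>
  have "p \<bullet> ssm_payoff S B q0 (rs[i := (c, p)]) i \<le> p \<bullet> ssm_payoff S B q0 (rs[i := r]) i"
    using opt r assms(4) by (auto simp: optimal_report_def)
  then have *: "?l * (p \<bullet> S p) \<le> ?l * (p \<bullet> S q)"
    using assms(3) by (simp add: ssm_payoff_list_update r inner_diff_right right_diff_distrib)
  \<comment> \<open>With weight 0 the optimal \<open>q\<close> is arbitrary but moves nothing; with
    positive weight strict properness forces \<open>q = p\<close>. The scaled displacements agree in
    both cases.\<close>
  have "?l *\<^sub>R (q - ?q') = ?l *\<^sub>R (p - ?q')"
  proof (cases "?l = 0")
    case False
    then have "0 < ?l"
      using weight_nonneg[OF r(2)] by simp
    then have "p \<bullet> S p \<le> p \<bullet> S q"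
      using * by (simp only: mult_le_cancel_left_pos)
    then have "q = p"
      using proper_S r(4) assms(4) unfolding proper_def by force
    then show ?thesis by simp
  qed (simp only: scaleR_zero_left)
  then have "ssm_update B ?q' r = (1 - ?l) *\<^sub>R ?q' + ?l *\<^sub>R p"
    by (simp add: r algebra_simps)
  moreover have "ssm_forecast B q0 (take (Suc i) (rs[i := r])) = ssm_update B ?q' r"
    using assms(3) by (simp add: ssm_forecast_take_Suc)
  ultimately show ?thesis
    using weight_nonneg[OF r(2)] unfolding closed_segment_def by force
qed

lemma ssm_worst_loss_le:
  assumes "q0 \<in> D"
  shows "ssm_worst_loss D S B q0 \<le> msr_worst_loss D S q0"
  unfolding ssm_worst_loss_def
proof (rule SUP_least, clarify)
  fix rs \<omega> assume "\<forall>r\<in>set rs. r \<in> reports D"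
  then have rs: "rs \<in> lists (reports D)"
    by blast
  \<comment> \<open>The comparison market reports the successive forecasts of the scaled mechanism;
    entry \<open>i\<close> is the forecast after report \<open>i\<close>, hence
    \<open>Suc i\<close>.\<close>
  define qs where "qs = map (\<lambda>i. ssm_forecast B q0 (take (Suc i) rs)) [0..<length rs]"
  have qs: "qs \<in> lists D" "length qs = length rs"
    using ssm_forecast_take_in[OF assms rs] by (auto simp: qs_def)
  have "ssm_payoff S B q0 rs i $ \<omega> \<le> msr_payoff S q0 qs i $ \<omega>" if i: "i < length rs" for i
  proof -
    obtain b q where r: "rs ! i = (b, q)" "0 \<le> b" "q \<in> D"
      using rs i by (rule report_nthE)
    let ?q' = "ssm_forecast B q0 (take i rs)"
    have "qs ! i = ssm_update B ?q' (b, q)"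
      using i by (simp add: qs_def ssm_forecast_take_Suc r del: ssm_update.simps)
    moreover have "(q0 # qs) ! i = ?q'"
      using i by (cases i) (auto simp: qs_def)
    ultimately show ?thesis
      using scaled_gain_le[OF ssm_forecast_take_in[OF assms rs] r(3,2)]
      by (simp add: ssm_payoff_def msr_payoff_def r del: ssm_update.simps)
  qed
  then have "(\<Sum>i<length rs. ssm_payoff S B q0 rs i $ \<omega>)
      \<le> (\<Sum>i<length qs. msr_payoff S q0 qs i $ \<omega>)"
    unfolding qs(2) by (intro sum_mono) simp
  then show "ereal (\<Sum>i<length rs. ssm_payoff S B q0 rs i $ \<omega>) \<le> msr_worst_loss D S q0"
    unfolding msr_worst_loss_def using qs(1) by (intro SUP_upper2[of "(qs, \<omega>)"]) auto
qed

lemma sybil_bound: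
  assumes "p \<in> D" "q' \<in> D" "rs \<in> lists (reports D)"
  defines "T \<equiv> \<lambda>rs. \<Sum>k<length rs. p \<bullet> ssm_payoff S B q' rs k"
  shows "T rs \<le> min 1 (sum_list (map fst rs) / B) * (p \<bullet> S p - p \<bullet> S q')"
proof -
  \<comment> \<open>The induction carries two extra facts: the first conjunct bounds what the next
    report can still gain, the last makes the weight of the combined budget nonnegative.\<close>
  have "T rs \<le> p \<bullet> S (ssm_forecast B q' rs) - p \<bullet> S q' \<and>
    T rs \<le> min 1 (sum_list (map fst rs) / B) * (p \<bullet> S p - p \<bullet> S q') \<and> 0 \<le> sum_list (map fst rs)"
    using assms(3)
  proof (induction rs rule: rev_induct)
    case Nil
    show ?case by (simp add: T_def)
  next
    case (snoc r rs)
    then have rs: "rs \<in> lists (reports D)" and "r \<in> reports D"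
      by auto
    then obtain b q where r: "r = (b, q)" "0 \<le> b" "q \<in> D"
      by (auto simp: reports_def)
    let ?q = "ssm_forecast B q' rs" and ?l = "min 1 (b / B)" and ?s = "sum_list (map fst rs)"
    let ?L = "min 1 (?s / B)" and ?g = "p \<bullet> S p - p \<bullet> S q'"
    have IH: "T rs \<le> p \<bullet> S ?q - p \<bullet> S q'" "T rs \<le> ?L * ?g" "0 \<le> ?s"
      using snoc.IH[OF rs] by auto
    have T: "T (rs @ [r]) = T rs + ?l * (p \<bullet> S q - p \<bullet> S ?q)"
      by (simp add: T_def ssm_payoff_append) (simp add: ssm_payoff_def r inner_diff_right)
    have l: "0 \<le> ?l" "?l \<le> 1" and L: "0 \<le> ?L" "?L \<le> 1"
      using weight_nonneg r(2) IH(3) by auto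
    have g: "0 \<le> ?g"
      using proper_le[OF proper_S assms(1,2)] by simp
    have "T (rs @ [r]) \<le> p \<bullet> S (ssm_forecast B q' (rs @ [r])) - p \<bullet> S q'"
      using expected_scaled_gain_le[OF assms(1) ssm_forecast_in[OF assms(2) rs] r(3,2)] IH(1)
      unfolding T by (simp add: r del: ssm_update.simps)
    moreover have "T (rs @ [r]) \<le> min 1 (sum_list (map fst (rs @ [r])) / B) * ?g"
    proof -
      \<comment> \<open>Properness bounds \<open>p \<bullet> S q\<close> by
        \<open>p \<bullet> S p\<close>, and the first conjunct bounds
        \<open>p \<bullet> S ?q\<close> below by \<open>p \<bullet> S q' + T rs\<close>.\<close>
      have "?l * (p \<bullet> S q - p \<bullet> S ?q) \<le> ?l * (?g - T rs)"
        using l proper_le[OF proper_S assms(1) r(3)] IH(1) by (intro mult_left_mono) auto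
      then have "T (rs @ [r]) \<le> (1 - ?l) * T rs + ?l * ?g"
        unfolding T by (simp add: algebra_simps)
      also have "\<dots> \<le> (1 - ?l) * (?L * ?g) + ?l * ?g"
        using l IH(2) by (intro add_right_mono mult_left_mono) auto
      also have "\<dots> = ((1 - ?l) * ?L + ?l) * ?g"
        by (simp add: algebra_simps)
      also have "\<dots> \<le> min 1 (sum_list (map fst (rs @ [r])) / B) * ?g"
      proof (rule mult_right_mono[OF _ g])
        \<comment> \<open>The two arguments of the minimum are treated separately:
          \<open>?L \<le> 1\<close> gives the bound 1, and dropping \<open>- ?l * ?L\<close> gives
          \<open>?L + ?l\<close>, at most the combined budget over \<open>B\<close>.\<close>
        have "(1 - ?l) * ?L + ?l \<le> (1 - ?l) * 1 + ?l"
          using l L by (intro add_right_mono mult_left_mono) auto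
        moreover have "(1 - ?l) * ?L + ?l \<le> 1 * ?L + ?l"
          using l L by (intro add_right_mono mult_right_mono) auto
        moreover have "?L \<le> ?s / B" "?l \<le> b / B"
          by auto
        ultimately show "(1 - ?l) * ?L + ?l \<le> min 1 (sum_list (map fst (rs @ [r])) / B)"
          unfolding min.bounded_iff by (simp add: r add_divide_distrib del: min.bounded_iff)
      qed
      finally show ?thesis .
    qed
    ultimately show ?case
      using IH(3) r by simp
  qed
  then show ?thesis
    by simp
qed

lemma sybil_proof:
  assumes "p \<in> D" "q' \<in> D" "rs \<in> lists (reports D)"
  shows "\<exists>q\<in>D. (\<Sum>k<length rs. p \<bullet> ssm_payoff S B q' rs k)
    \<le> p \<bullet> ssm_payoff S B q' [(sum_list (map fst rs), q)] 0"
  \<comment> \<open>The single report is the true belief \<open>p\<close>, whose payoff attains the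
    bound exactly.\<close>
  using sybil_bound[OF assms] assms(1)
  by (intro bexI[of _ p]) (simp_all add: ssm_payoff_def inner_diff_right)

end

theorem theorem11:
  fixes D :: "(real ^ 'w::finite) set"
    and S :: "real ^ 'w \<Rightarrow> real ^ 'w"
    and B :: real
    and q0 :: "real ^ 'w"
  assumes "D \<subseteq> distributions"
    and "convex D"
    and "proper D S"
    and "\<And>\<omega>. concave_on D (\<lambda>q. S q $ \<omega>)"
    and "B > 0"
    and "\<And>q' q. q' \<in> D \<Longrightarrow> q \<in> D \<Longrightarrow> natural_budget S q' q \<le> B"
    and "q0 \<in> D"
  shows
    "(\<forall>rs\<in>lists (reports D). \<forall>i<length rs. \<forall>p\<in>D. \<forall>b\<ge>0.
        optimal_report D S B q0 rs i p b (b, p)) \<and>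
     (\<forall>rs\<in>lists (reports D). \<forall>i<length rs. \<forall>\<omega>.
        ssm_payoff S B q0 rs i $ \<omega> \<ge> - fst (rs ! i)) \<and>
     (\<forall>rs\<in>lists (reports D). \<forall>i<length rs. \<forall>p\<in>D. \<forall>b\<ge>0. \<forall>r.
        optimal_report D S B q0 rs i p b r \<longrightarrow>
        ssm_forecast B q0 (take (Suc i) (rs[i := r]))
          \<in> closed_segment (ssm_forecast B q0 (take i rs)) p) \<and>
     ssm_worst_loss D S B q0 \<le> msr_worst_loss D S q0 \<and>
     (\<forall>p\<in>D. \<forall>q'\<in>D. \<forall>rs\<in>lists (reports D). \<exists>q\<in>D.
        p \<bullet> ssm_payoff S B q' [(sum_list (map fst rs), q)] 0
          \<ge> (\<Sum>k<length rs. p \<bullet> ssm_payoff S B q' rs k))"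
proof -
  interpret scaled_scoring D S B
    using assms by unfold_locales auto
  show ?thesis
    using \<open>q0 \<in> D\<close>
    by (intro conjI ballI allI impI)
      (rule truthful_optimal no_default optimal_report_update ssm_worst_loss_le
        sybil_proof; assumption)+
qed

end
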